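(* Let $n,p\in\{1,2,3,\ldots\}$, let $A,B\in\mathbb{R}^{p\times n}$ with $\operatorname{rank}(A\ B)=p$, and let $G:\mathbb{R}^n\rightrightarrows\mathbb{R}^n$ be the linear relation with $\operatorname{gra} G=\{(x,x^* )\in\mathbb{R}^n\times\mathbb{R}^n\mid Ax+Bx^*=0\}$. Let $v_1,\ldots,v_p$ be an orthonormal basis of $\mathbb{R}^p$ consisting of eigenvectors of $AB^{\intercal}+BA^{\intercal}$ with eigenvalues $\lambda_1,\ldots,\lambda_p$ respectively, listed so that all positive eigenvalues (counting multiplicity) $\lambda_1,\ldots,\lambda_k$ come first and $\lambda_{k+1},\ldots,\lambda_p\le0$. Assume that $G$ is monotone. Let $V_g$ be the matrix with rows $v_{p-n+1}^{\intercal},v_{p-n+2}^{\intercal},\ldots,v_p^{\intercal}$. Then $$\operatorname{gra} G+\{(B^{\intercal}u,A^{\intercal}u)\mid u\in\mathbf{V_+}(BA^{\intercal})\}=\{(x,x^* )\mid V_gAx+V_gBx^*=0\},$$ and the linear relation $\widetilde G$ having this subspace as its graph is a maximally monotone extension of $G$.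
   Context: $\mathbb{R}^n$ carries the Euclidean inner product $\langle\cdot,\cdot\rangle$. A set-valued operator $T:\mathbb{R}^n\rightrightarrows\mathbb{R}^n$ is identified with its graph $\operatorname{gra}T=\{(x,x^* )\mid x^*\in Tx\}$; it is a linear relation if $\operatorname{gra}T$ is a linear subspace. $T$ is monotone if $\langle x-y,x^*-y^*\rangle\ge0$ for all $(x,x^* ),(y,y^* )\in\operatorname{gra}T$, and maximally monotone if it is monotone and has no proper monotone extension (in the sense of graph inclusion, among all set-valued operators). $S$ is an extension of $T$ if $\operatorname{gra}T\subseteq\operatorname{gra}S$. For a square matrix $M$, $\mathbf{V_+}(M)$ denotes the span of the eigenvectors of the symmetric matrix $M+M^{\intercal}$ belonging to positive eigenvalues. (When $G$ is monotone, one has $p\ge n$ and $k=p-n$.) *)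

theory Defs
  imports "HOL-Analysis.Analysis"
begin

definition gra :: "('a \<Rightarrow> 'b set) \<Rightarrow> ('a \<times> 'b) set" where
  "gra T = {(x, x'). x' \<in> T x}"

definition operator_of :: "('a \<times> 'b) set \<Rightarrow> 'a \<Rightarrow> 'b set" where
  "operator_of S x = {x'. (x, x') \<in> S}"

lemma gra_operator_of [simp]: "gra (operator_of S) = S"
  by (auto simp: gra_def operator_of_def)

lemma operator_of_gra [simp]: "operator_of (gra T) = T"
  by (auto simp: gra_def operator_of_def fun_eq_iff)

definition linear_relation :: "('a::real_vector \<Rightarrow> 'b::real_vector set) \<Rightarrow> bool" where
  "linear_relation T \<longleftrightarrow> subspace (gra T)"

definition extends :: "('a \<Rightarrow> 'b set) \<Rightarrow> ('a \<Rightarrow> 'b set) \<Rightarrow> bool" where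
  "extends S T \<longleftrightarrow> gra T \<subseteq> gra S"

definition monotone_operator :: "('a::real_inner \<Rightarrow> 'a set) \<Rightarrow> bool" where
  "monotone_operator T \<longleftrightarrow>
     (\<forall>(x, x') \<in> gra T. \<forall>(y, y') \<in> gra T. inner (x - y) (x' - y') \<ge> 0)"

definition maximally_monotone :: "('a::real_inner \<Rightarrow> 'a set) \<Rightarrow> bool" where
  "maximally_monotone T \<longleftrightarrow>
     monotone_operator T \<and> (\<forall>S. monotone_operator S \<and> extends S T \<longrightarrow> S = T)"

definition eigenvector :: "real^'n^'n \<Rightarrow> real^'n \<Rightarrow> real \<Rightarrow> bool" where
  "eigenvector M v c \<longleftrightarrow> v \<noteq> 0 \<and> M *v v = c *\<^sub>R v"

definition V_plus :: "real^'n^'n \<Rightarrow> (real^'n) set" where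
  "V_plus M = span {v. \<exists>c>0. eigenvector (M + transpose M) v c}"

definition orthonormal_basis :: "'i set \<Rightarrow> ('i \<Rightarrow> 'a::real_inner) \<Rightarrow> bool" where
  "orthonormal_basis I v \<longleftrightarrow>
     (\<forall>i\<in>I. \<forall>j\<in>I. inner (v i) (v j) = (if i = j then 1 else 0)) \<and> span (v ` I) = UNIV"

definition hcat :: "'a^'m^'p \<Rightarrow> 'a^'n^'p \<Rightarrow> 'a^('m + 'n)^'p" where
  "hcat A B = (\<chi> i j. case j of Inl l \<Rightarrow> A $ i $ l | Inr r \<Rightarrow> B $ i $ r)"

text \<open>The matrix with rows \<open>v (p - n + 1), \<dots>, v p\<close>, where \<open>n = CARD('n)\<close> and
  \<open>p = CARD('p)\<close>.  As \<open>'n\<close> carries no order, the row positions \<open>1, \<dots>, n\<close> are given by a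
  numbering \<open>pos\<close> of \<open>'n\<close>.  The natural-number subtraction is the intended one
  only if \<open>n \<le> p\<close>.\<close>

definition last_rows :: "('n \<Rightarrow> nat) \<Rightarrow> (nat \<Rightarrow> real^'p) \<Rightarrow> real^'p^'n" where
  "last_rows pos v = (\<chi> i. v (CARD('p) - CARD('n) + pos i))"

end

theory Submission
  imports Defs
begin

text \<open>Give \<open>\<real>\<^sup>n \<times> \<real>\<^sup>n\<close> the symmetric bilinear form
  \<open>b ((x, x'), (y, y')) = x \<bullet> y' + x' \<bullet> y\<close> and let \<open>J u = (B\<^sup>T u, A\<^sup>T u)\<close>.  Then
  \<open>b (z, J u) = (A x + B x') \<bullet> u\<close>, so \<open>gra G\<close> is the \<open>b\<close>-orthogonal complement of the range of \<open>J\<close>,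
  and \<open>J\<close> pulls \<open>b\<close> back to \<open>A B\<^sup>T + B A\<^sup>T\<close>.  Hence \<open>gra G + J V\<^sub>+\<close> is the \<open>b\<close>-orthogonal
  complement of the images of the eigenvectors with nonpositive eigenvalues, and \<open>b\<close> is
  nonnegative on it.  A subspace on which \<open>b\<close> is nonnegative (nonpositive) meets the antidiagonal
  (diagonal) trivially; these two facts bound the number of nonpositive eigenvalues by \<open>n\<close> from
  below and from above.  Finally, a monotone subspace that together with the antidiagonal spans
  the whole space is maximally monotone.\<close>

text \<open>This rule rewrites \<open>transpose A *v u\<close> to \<open>u v* A\<close>; removing it
  keeps the adjoint calculations in one form.\<close>

declare transpose_matrix_vector [simp del]

section \<open>Adjoints, orthonormal bases and full row rank\<close>

lemma inner_transpose_mult: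
  fixes A :: "real^'n^'m"
  shows "x \<bullet> (transpose A *v u) = (A *v x) \<bullet> u"
  by (metis dot_lmul_matrix inner_commute transpose_matrix_vector)

lemma inner_symmetrized_mult:
  fixes M :: "real^'n^'n"
  shows "((M + transpose M) *v x) \<bullet> y = x \<bullet> ((M + transpose M) *v y)"
  unfolding matrix_vector_mult_add_rdistrib inner_add_left inner_add_right inner_transpose_mult
  by (metis add.commute inner_commute inner_transpose_mult)

lemma orthonormal_basis_eq_0:
  assumes "orthonormal_basis I v" and "\<And>i. i \<in> I \<Longrightarrow> x \<bullet> v i = 0"
  shows "x = 0"
proof -
  have "orthogonal x y" if "y \<in> span (v ` I)" for y
    using that assms(2) by (intro orthogonal_to_span[of y "v ` I"]) (auto simp: orthogonal_def)
  then show ?thesis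
    using assms(1) by (metis UNIV_I orthogonal_self orthonormal_basis_def)
qed

lemma inner_sum_orthonormal:
  assumes "orthonormal_basis I v" and "finite I" and "P \<subseteq> I" and "j \<in> I"
  shows "(\<Sum>i\<in>P. c i *\<^sub>R v i) \<bullet> v j = (if j \<in> P then c j else 0)"
proof -
  have "(\<Sum>i\<in>P. c i *\<^sub>R v i) \<bullet> v j = (\<Sum>i\<in>P. if i = j then c i else 0)"
    unfolding inner_sum_left
    using assms by (intro sum.cong) (auto simp: orthonormal_basis_def)
  then show ?thesis
    using assms by (simp add: finite_subset)
qed

lemma orthonormal_basis_expansion:
  assumes "orthonormal_basis I v" and "finite I"
  shows "(\<Sum>i\<in>I. (x \<bullet> v i) *\<^sub>R v i) = x"
proof -
  have "(\<Sum>i\<in>I. (x \<bullet> v i) *\<^sub>R v i) - x = 0"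
    by (rule orthonormal_basis_eq_0[OF assms(1)])
      (simp add: inner_diff_left inner_sum_orthonormal[OF assms subset_refl])
  then show ?thesis by simp
qed

lemma dim_span_orthonormal:
  fixes v :: "'i \<Rightarrow> 'a::euclidean_space"
  assumes "orthonormal_basis I v" and "P \<subseteq> I"
  shows "dim (span (v ` P)) = card P"
proof -
  have orth: "v i \<bullet> v j = (if i = j then 1 else 0)" if "i \<in> P" "j \<in> P" for i j
    using that assms by (simp add: orthonormal_basis_def subset_iff)
  have inj: "inj_on v P"
    by (rule inj_onI) (metis orth zero_neq_one)
  have "pairwise orthogonal (v ` P)"
    by (auto simp: pairwise_def orthogonal_def orth)
  moreover have "0 \<notin> v ` P"
    using orth by force
  ultimately have "independent (v ` P)"
    by (rule pairwise_orthogonal_independent)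
  then show ?thesis
    by (simp add: dim_eq_card_independent card_image inj)
qed

text \<open>The two equations stack to \<open>transpose (hcat A B) *v u = 0\<close>, and a matrix of
  full row rank has an injective transpose.\<close>

lemma full_row_rank_transpose_eq_0:
  fixes A B :: "real^'n^'p"
  assumes "rank (hcat A B) = CARD('p)" and "transpose A *v u = 0" and "transpose B *v u = 0"
  shows "u = 0"
proof -
  have "(transpose (hcat A B) *v u) $ j = 0" for j
  proof (cases j)
    case (Inl l)
    then show ?thesis
      using arg_cong[OF assms(2), of "\<lambda>w. w $ l"]
      by (simp add: matrix_vector_mult_def transpose_def hcat_def)
  next
    case (Inr l)
    then show ?thesis
      using arg_cong[OF assms(3), of "\<lambda>w. w $ l"]
      by (simp add: matrix_vector_mult_def transpose_def hcat_def)
  qed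
  then have "transpose (hcat A B) *v u = transpose (hcat A B) *v 0"
    by (simp add: vec_eq_iff)
  moreover have "inj ((*v) (transpose (hcat A B)))"
    using assms(1) full_rank_injective[of "transpose (hcat A B)"] by (simp add: rank_transpose)
  ultimately show ?thesis
    by (metis injD)
qed

section \<open>Monotone and maximally monotone subspaces\<close>

lemma monotone_subspace_iff:
  fixes S :: "('a::real_inner \<times> 'a) set"
  assumes "subspace S"
  shows "monotone_operator (operator_of S) \<longleftrightarrow> (\<forall>(x, x')\<in>S. 0 \<le> x \<bullet> x')"
proof
  assume "monotone_operator (operator_of S)"
  moreover have "(0, 0) \<in> S"
    using subspace_0[OF assms] by (simp add: zero_prod_def)
  ultimately show "\<forall>(x, x')\<in>S. 0 \<le> x \<bullet> x'"
    unfolding monotone_operator_def by fastforce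
next
  assume *: "\<forall>(x, x')\<in>S. 0 \<le> x \<bullet> x'"
  have "0 \<le> (x - y) \<bullet> (x' - y')" if "(x, x') \<in> S" "(y, y') \<in> S" for x x' y y'
    using subspace_diff[OF assms that] * by auto
  then show "monotone_operator (operator_of S)"
    unfolding monotone_operator_def by auto
qed

text \<open>A point of a monotone extension differs from some point of \<open>S\<close> by an
  antidiagonal vector \<open>(d, - d)\<close>. Monotonicity between these two points reads
  \<open>0 \<le> - (d \<bullet> d)\<close>, so they coincide.\<close>

lemma maximally_monotone_if_antidiagonal_complement:
  fixes S :: "('a::real_inner \<times> 'a) set"
  assumes "monotone_operator (operator_of S)"
    and span: "\<And>x x'. \<exists>d. (x - d, x' + d) \<in> S"
  shows "maximally_monotone (operator_of S)"
  unfolding maximally_monotone_def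
proof (intro conjI allI impI)
  fix T assume T: "monotone_operator T \<and> extends T (operator_of S)"
  then have sub: "S \<subseteq> gra T"
    by (simp add: extends_def)
  have "(x, x') \<in> S" if z: "(x, x') \<in> gra T" for x x'
  proof -
    obtain d where d: "(x - d, x' + d) \<in> S"
      using span by blast
    have "0 \<le> (x - (x - d)) \<bullet> (x' - (x' + d))"
      using T z d sub unfolding monotone_operator_def by blast
    then have "d \<bullet> d \<le> 0"
      by simp
    then have "d = 0"
      by (metis inner_gt_zero_iff not_less)
    with d show ?thesis by simp
  qed
  with sub have "gra T = S"
    by auto
  then show "T = operator_of S"
    by (metis operator_of_gra)
qed (fact assms(1))

section \<open>The span of the eigenvectors with positive eigenvalues\<close>

lemma V_plus_orthogonal:
  assumes "u \<in> V_plus M" and "eigenvector (M + transpose M) w c" and "c \<le> 0"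
  shows "u \<bullet> w = 0"
proof -
  have "orthogonal w y" if y: "\<exists>c>0. eigenvector (M + transpose M) y c" for y
  proof -
    obtain a where a: "a > 0" "(M + transpose M) *v y = a *\<^sub>R y"
      using y by (auto simp: eigenvector_def)
    \<comment> \<open>Moving the symmetric matrix across the inner product shows that both sides are
      the same number; as \<open>c \<le> 0 < a\<close>, it follows that
      \<open>y \<bullet> w = 0\<close>.\<close>
    have "a * (y \<bullet> w) = c * (y \<bullet> w)"
      using inner_symmetrized_mult[of M y w] assms(2) a by (simp add: eigenvector_def)
    then show ?thesis
      using a(1) assms(3) by (auto simp: orthogonal_def inner_commute)
  qed
  then have "orthogonal w u"
    using assms(1) unfolding V_plus_def by (rule orthogonal_to_span[rotated]) simp
  then show ?thesis
    by (simp add: orthogonal_def inner_commute)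
qed

text \<open>In the eigenbasis the symmetrized form, which is twice the form of \<open>M\<close>, is
  a sum of terms \<open>lam i * (u \<bullet> v i)^2\<close>. Those with \<open>lam i \<le> 0\<close>
  vanish because \<open>u\<close> is orthogonal to such \<open>v i\<close>.\<close>

lemma V_plus_nonneg:
  fixes M :: "real^'p^'p"
  assumes "finite I" and basis: "orthonormal_basis I v"
    and eig: "\<And>i. i \<in> I \<Longrightarrow> eigenvector (M + transpose M) (v i) (lam i)"
    and u: "u \<in> V_plus M"
  shows "0 \<le> u \<bullet> (M *v u)"
proof -
  let ?L = "M + transpose M"
  have "0 \<le> (u \<bullet> v i) * (v i \<bullet> (?L *v u))" if i: "i \<in> I" for i
  proof (cases "lam i \<le> 0")
    case True
    then show ?thesis
      using V_plus_orthogonal[OF u eig[OF i]] by simp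
  next
    case False
    have "v i \<bullet> (?L *v u) = lam i * (u \<bullet> v i)"
      using inner_symmetrized_mult[of M "v i" u] eig[OF i]
      by (simp add: eigenvector_def inner_commute)
    with False show ?thesis
      by (simp add: mult.left_commute)
  qed
  then have "0 \<le> (\<Sum>i\<in>I. (u \<bullet> v i) *\<^sub>R v i) \<bullet> (?L *v u)"
    by (auto simp: inner_sum_left intro: sum_nonneg)
  then have "0 \<le> u \<bullet> (?L *v u)"
    by (simp add: orthonormal_basis_expansion[OF basis assms(1)])
  also have "u \<bullet> (?L *v u) = 2 * (u \<bullet> (M *v u))"
    by (simp add: matrix_vector_mult_add_rdistrib inner_add_right inner_transpose_mult
        inner_commute[of "M *v u"])
  finally show ?thesis by simp
qed

section \<open>The relation and its extension, for an unordered eigenbasis\<close>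

locale eigenbasis_relation =
  fixes A B :: "real^'n^'p" and I :: "'i set" and v :: "'i \<Rightarrow> real^'p" and lam :: "'i \<Rightarrow> real"
  assumes fin: "finite I"
    and basis: "orthonormal_basis I v"
    and eig: "i \<in> I \<Longrightarrow>
      eigenvector (B ** transpose A + transpose (B ** transpose A)) (v i) (lam i)"
begin

abbreviation ker :: "((real^'n) \<times> (real^'n)) set" where
  "ker \<equiv> {(x, x'). A *v x + B *v x' = 0}"

text \<open>The inner product with \<open>v i\<close> is the pairing of \<open>(x, x')\<close> with
  \<open>J (v i)\<close>, so this is the orthogonal complement of the images of the nonpositive
  eigenvectors.\<close>

abbreviation ext :: "((real^'n) \<times> (real^'n)) set" where
  "ext \<equiv> {(x, x'). \<forall>i\<in>I. lam i \<le> 0 \<longrightarrow> (A *v x + B *v x') \<bullet> v i = 0}"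

lemma mult_transposes:
  "A *v (transpose B *v u) + B *v (transpose A *v u) =
    (B ** transpose A + transpose (B ** transpose A)) *v u"
  unfolding matrix_vector_mul_assoc matrix_transpose_mul matrix_vector_mult_add_rdistrib
    transpose_transpose by (rule add.commute)

lemma inner_mult_transposes:
  assumes "i \<in> I"
  shows "(A *v (transpose B *v u) + B *v (transpose A *v u)) \<bullet> v i = lam i * (u \<bullet> v i)"
  using eig[OF assms] unfolding mult_transposes inner_symmetrized_mult
  by (simp add: eigenvector_def)

lemma ker_plus_V_plus:
  "ker + {(transpose B *v u, transpose A *v u) | u. u \<in> V_plus (B ** transpose A)} = ext"
    (is "_ + ?W = _")
proof
  show "ker + ?W \<subseteq> ext"
  proof
    fix z assume "z \<in> ker + ?W"
    then obtain x x' u where z: "z = (x + transpose B *v u, x' + transpose A *v u)"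
      and x: "A *v x + B *v x' = 0" and u: "u \<in> V_plus (B ** transpose A)"
      by (auto simp: set_plus_def)
    have "A *v (x + transpose B *v u) + B *v (x' + transpose A *v u) =
        A *v (transpose B *v u) + B *v (transpose A *v u)"
      using x by (simp add: matrix_vector_right_distrib algebra_simps)
    then show "z \<in> ext"
      unfolding z using V_plus_orthogonal[OF u eig] by (auto simp: inner_mult_transposes)
  qed
  show "ext \<subseteq> ker + ?W"
  proof
    fix z assume "z \<in> ext"
    then obtain x x' where z: "z = (x, x')"
      and x: "\<And>i. i \<in> I \<Longrightarrow> lam i \<le> 0 \<Longrightarrow> (A *v x + B *v x') \<bullet> v i = 0"
      by auto
    define y where "y = A *v x + B *v x'"
    define P where "P = {i \<in> I. lam i > 0}"
    \<comment> \<open>The symmetrized matrix is invertible on its positive eigenspace;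
      \<open>u\<close> is the preimage there of the positive part of \<open>y\<close>. The other
      coordinates of \<open>y\<close> vanish by assumption, so \<open>(x, x')\<close> minus
      \<open>J u\<close> lies in \<open>ker\<close>.\<close>
    define u where "u = (\<Sum>i\<in>P. (y \<bullet> v i / lam i) *\<^sub>R v i)"
    have u: "u \<in> V_plus (B ** transpose A)"
      unfolding u_def V_plus_def
      by (intro span_sum span_scale span_base) (use eig in \<open>auto simp: P_def\<close>)
    have "y - (A *v (transpose B *v u) + B *v (transpose A *v u)) = 0"
    proof (rule orthonormal_basis_eq_0[OF basis])
      fix i assume i: "i \<in> I"
      have "u \<bullet> v i = (if i \<in> P then y \<bullet> v i / lam i else 0)"
        unfolding u_def by (rule inner_sum_orthonormal[OF basis fin _ i]) (auto simp: P_def)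
      then show "(y - (A *v (transpose B *v u) + B *v (transpose A *v u))) \<bullet> v i = 0"
        unfolding inner_diff_left inner_mult_transposes[OF i]
        using i x[OF i] by (auto simp: P_def y_def)
    qed
    then have "(x - transpose B *v u, x' - transpose A *v u) \<in> ker"
      by (simp add: y_def matrix_vector_mult_diff_distrib algebra_simps)
    then have "(x - transpose B *v u, x' - transpose A *v u) +
        (transpose B *v u, transpose A *v u) \<in> ker + ?W"
      using u by (intro set_plus_intro) blast+
    then show "z \<in> ker + ?W"
      by (simp add: z)
  qed
qed

lemma linear_mult_pair: "linear (\<lambda>(x, x'). A *v x + B *v x')"
  by (rule linearI)
    (auto simp: matrix_vector_right_distrib matrix_vector_mult_scaleR scaleR_add_right)

lemma subspace_ker: "subspace ker"
proof -
  have "ker = {z. (case z of (x, x') \<Rightarrow> A *v x + B *v x') = 0}"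
    by auto
  then show ?thesis
    using linear_subspace_kernel[OF linear_mult_pair] by simp
qed

lemma subspace_ext: "subspace ext"
proof -
  have "ext = (\<lambda>(x, x'). A *v x + B *v x') -` (\<Inter>i\<in>{i \<in> I. lam i \<le> 0}. {y. y \<bullet> v i = 0})"
    by auto
  then show ?thesis
    by (auto intro!: linear_subspace_vimage linear_mult_pair subspace_Inter subspace_hyperplane2)
qed

text \<open>Split a point as \<open>(g, g')\<close> in \<open>ker\<close> plus \<open>J u\<close>.
  The cross term of \<open>x \<bullet> x'\<close> is
  \<open>(A *v g + B *v g') \<bullet> u = 0\<close>, and the two remaining terms are
  nonnegative.\<close>

lemma monotone_ext:
  assumes "monotone_operator (operator_of ker)"
  shows "monotone_operator (operator_of ext)"
  unfolding monotone_subspace_iff[OF subspace_ext]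
proof clarify
  fix x x' assume "\<forall>i\<in>I. lam i \<le> 0 \<longrightarrow> (A *v x + B *v x') \<bullet> v i = 0"
  then have "(x, x') \<in> ker +
      {(transpose B *v u, transpose A *v u) | u. u \<in> V_plus (B ** transpose A)}"
    unfolding ker_plus_V_plus by simp
  then obtain g g' u where x: "x = g + transpose B *v u" "x' = g' + transpose A *v u"
    and g: "A *v g + B *v g' = 0" and u: "u \<in> V_plus (B ** transpose A)"
    by (auto simp: set_plus_def)
  have "0 \<le> g \<bullet> g'"
    using assms g monotone_subspace_iff[OF subspace_ker] by auto
  moreover have "0 \<le> u \<bullet> (B ** transpose A *v u)"
    using fin basis eig u by (rule V_plus_nonneg)
  moreover have "x \<bullet> x' = g \<bullet> g' + (A *v g + B *v g') \<bullet> u + u \<bullet> (B ** transpose A *v u)"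
  proof -
    have "(transpose B *v u) \<bullet> w = (B *v w) \<bullet> u" for w
      by (metis inner_commute inner_transpose_mult)
    then show ?thesis
      unfolding x
      by (simp add: inner_add_left inner_add_right inner_transpose_mult[of g]
          inner_commute[of u] del: matrix_vector_mul_assoc flip: matrix_vector_mul_assoc)
  qed
  ultimately show "0 \<le> x \<bullet> x'"
    using g by simp
qed

section \<open>Counting the nonpositive eigenvalues\<close>

lemma antidiagonal_ext_eq_0:
  assumes "monotone_operator (operator_of ker)" and "(d, - d) \<in> ext"
  shows "d = 0"
proof -
  have "0 \<le> d \<bullet> - d"
    using monotone_ext[OF assms(1)] assms(2)
    unfolding monotone_subspace_iff[OF subspace_ext] by blast
  then have "d \<bullet> d \<le> 0"
    by simp
  then show ?thesis
    by (metis inner_gt_zero_iff not_less)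
qed

text \<open>\<open>E\<close> evaluates \<open>A\<close> and \<open>B\<close> at
  \<open>(d, - d)\<close> and projects onto the span of the nonpositive eigenvectors. Its kernel
  consists of antidiagonal points of \<open>ext\<close>, so \<open>E\<close> embeds the
  n-dimensional space into that span.\<close>

lemma card_nonpos_ge:
  assumes "monotone_operator (operator_of ker)"
  shows "CARD('n) \<le> card {i \<in> I. lam i \<le> 0}"
proof -
  define N where "N = {i \<in> I. lam i \<le> 0}"
  define E where "E d = (\<Sum>i\<in>N. ((A *v d - B *v d) \<bullet> v i) *\<^sub>R v i)" for d
  have lin: "linear E"
    unfolding E_def
    by (rule linearI) (simp_all add: matrix_vector_right_distrib matrix_vector_mult_scaleR
        algebra_simps inner_add_left inner_diff_left sum.distrib sum_subtractf scaleR_sum_right)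
  have "d = 0" if "E d = 0" for d
  proof (rule antidiagonal_ext_eq_0[OF assms])
    have "E d \<bullet> v i = (A *v d - B *v d) \<bullet> v i" if "i \<in> N" for i
      unfolding E_def
      using that by (subst inner_sum_orthonormal[OF basis fin]) (auto simp: N_def)
    then show "(d, - d) \<in> ext"
      using that by (auto simp: N_def vec.neg)
  qed
  then have "inj E"
    using lin by (simp add: linear_injective_0)
  then have "dim (range E) = CARD('n)"
    using lin by (simp add: dim_image_eq)
  moreover have "range E \<subseteq> span (v ` N)"
    unfolding E_def by (intro image_subsetI span_sum span_scale span_base imageI)
  then have "dim (range E) \<le> dim (span (v ` N))"
    by (rule dim_subset)
  moreover have "dim (span (v ` N)) = card N"
    by (intro dim_span_orthonormal[OF basis]) (auto simp: N_def)
  ultimately show ?thesis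
    by (simp add: N_def)
qed

text \<open>If \<open>F u = 0\<close>, then \<open>J u\<close> lies on the diagonal, where the
  quadratic form at \<open>u\<close> is twice the squared norm of \<open>transpose A *v u\<close>.
  On the span of the nonpositive eigenvectors the form is at most 0, so both transposes kill
  \<open>u\<close> and full rank gives \<open>u = 0\<close>. Thus \<open>F\<close> embeds this span
  into the n-dimensional space.\<close>

lemma card_nonpos_le:
  assumes "rank (hcat A B) = CARD('p)"
  shows "card {i \<in> I. lam i \<le> 0} \<le> CARD('n)"
proof -
  define N where "N = {i \<in> I. lam i \<le> 0}"
  define F where "F u = transpose B *v u - transpose A *v u" for u
  have lin: "linear F"
    unfolding F_def
    by (rule linearI) (simp_all add: matrix_vector_right_distrib matrix_vector_mult_scaleR
        algebra_simps)
  have zero: "u = 0" if u: "u \<in> span (v ` N)" and F: "F u = 0" for u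
  proof -
    have perp: "u \<bullet> v i = 0" if "i \<in> I - N" for i
    proof -
      have "orthogonal (v i) u"
        using u that basis
        by (intro orthogonal_to_span[of u "v ` N"])
          (auto simp: N_def orthogonal_def orthonormal_basis_def)
      then show ?thesis by (simp add: orthogonal_def inner_commute)
    qed
    let ?y = "A *v (transpose B *v u) + B *v (transpose A *v u)"
    have "?y \<bullet> u = ?y \<bullet> (\<Sum>i\<in>I. (u \<bullet> v i) *\<^sub>R v i)"
      by (simp only: orthonormal_basis_expansion[OF basis fin])
    also have "\<dots> = (\<Sum>i\<in>I. lam i * (u \<bullet> v i)\<^sup>2)"
      unfolding inner_sum_right
      by (intro sum.cong) (simp_all only: inner_scaleR_right inner_mult_transposes,
          simp add: power2_eq_square)
    also have "\<dots> \<le> 0"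
    proof (rule sum_nonpos)
      fix i assume "i \<in> I"
      then show "lam i * (u \<bullet> v i)\<^sup>2 \<le> 0"
        using perp[of i] by (cases "i \<in> N") (auto simp: N_def mult_nonpos_nonneg)
    qed
    finally have "?y \<bullet> u \<le> 0" .
    moreover have "?y \<bullet> u = 2 * ((transpose A *v u) \<bullet> (transpose A *v u))"
      using F by (simp add: F_def inner_add_left inner_transpose_mult[symmetric])
    ultimately have "transpose A *v u = 0"
      by (metis inner_ge_zero inner_eq_zero_iff antisym mult_le_0_iff not_numeral_le_zero)
    with F show ?thesis
      using full_row_rank_transpose_eq_0[OF assms] by (simp add: F_def)
  qed
  have "inj_on F (span (v ` N))"
    using linear_injective_on_subspace_0[OF lin subspace_span] zero by auto
  then have "dim (F ` span (v ` N)) = dim (span (v ` N))"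
    by (intro dim_image_eq[OF lin]) (simp add: span_span)
  also have "\<dots> = card N"
    by (intro dim_span_orthonormal[OF basis]) (auto simp: N_def)
  finally show ?thesis
    using dim_subset_UNIV_cart[of "F ` span (v ` N)"] by (simp add: N_def)
qed

end

section \<open>The matrix form of the extension and its maximality\<close>

theorem corollary3p4:
  fixes A B :: "real^'n^'p"
    and G :: "real^'n \<Rightarrow> (real^'n) set"
    and v :: "nat \<Rightarrow> real^'p"
    and lam :: "nat \<Rightarrow> real"
    and k :: nat
    and pos :: "'n \<Rightarrow> nat"
  assumes "rank (hcat A B) = CARD('p)"
    and "gra G = {(x, x'). A *v x + B *v x' = 0}"
    and "orthonormal_basis {1..CARD('p)} v"
    and "\<forall>i\<in>{1..CARD('p)}. eigenvector (A ** transpose B + B ** transpose A) (v i) (lam i)"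
    and "k \<le> CARD('p)"
    and "\<forall>i\<in>{1..k}. lam i > 0"
    and "\<forall>i\<in>{k+1..CARD('p)}. lam i \<le> 0"
    and "monotone_operator G"
    and "bij_betw pos UNIV {1..CARD('n)}"
  defines "Vg \<equiv> last_rows pos v"
    and "S \<equiv> gra G + {(transpose B *v u, transpose A *v u) | u. u \<in> V_plus (B ** transpose A)}"
  shows "S = {(x, x'). (Vg ** A) *v x + (Vg ** B) *v x' = 0}
    \<and> linear_relation (operator_of S)
    \<and> extends (operator_of S) G
    \<and> maximally_monotone (operator_of S)"
proof -
  have "eigenbasis_relation A B {1..CARD('p)} v lam"
    using assms(3,4) by unfold_locales (auto simp: matrix_transpose_mul add.commute)
  then interpret eigenbasis_relation A B "{1..CARD('p)}" v lam .
  have ker: "operator_of ker = G"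
    by (metis assms(2) operator_of_gra)
  have nonpos: "{i \<in> {1..CARD('p)}. lam i \<le> 0} = {k+1..CARD('p)}"
  proof (intro subset_antisym subsetI)
    fix i assume i: "i \<in> {i \<in> {1..CARD('p)}. lam i \<le> 0}"
    then have "i \<notin> {1..k}"
      using assms(6) leD by blast
    with i show "i \<in> {k+1..CARD('p)}"
      by simp
  next
    fix i assume "i \<in> {k+1..CARD('p)}"
    with assms(7) show "i \<in> {i \<in> {1..CARD('p)}. lam i \<le> 0}"
      by simp
  qed
  \<comment> \<open>The two bounds meet, so \<open>k\<close> is the offset in
    \<open>last_rows\<close> and no subtraction is truncated.\<close>
  have "CARD('p) - k = CARD('n)"
    using card_nonpos_ge card_nonpos_le[OF assms(1)] assms(8) unfolding nonpos ker by simp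
  with assms(5) have k: "CARD('p) - CARD('n) = k" "k + CARD('n) = CARD('p)"
    by auto
  \<comment> \<open>Since \<open>pos\<close> counts from 1, the rows of \<open>Vg\<close> are
    exactly the nonpositive eigenvectors.\<close>
  have "range (\<lambda>i. k + pos i) = {k+1..CARD('p)}"
  proof -
    have "range (\<lambda>i. k + pos i) = (+) k ` range pos"
      by auto
    also have "\<dots> = {k+1..CARD('p)}"
      using assms(9) k(2) by (simp add: bij_betw_def)
    finally show ?thesis .
  qed
  then have Vg_iff: "Vg *v y = 0 \<longleftrightarrow> (\<forall>i\<in>{1..CARD('p)}. lam i \<le> 0 \<longrightarrow> y \<bullet> v i = 0)" for y
  proof -
    have "(Vg *v y) $ i = y \<bullet> v (k + pos i)" for i
      by (simp add: Vg_def last_rows_def k(1) matrix_vector_mul_component inner_commute)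
    then have "Vg *v y = 0 \<longleftrightarrow> (\<forall>j\<in>range (\<lambda>i. k + pos i). y \<bullet> v j = 0)"
      by (simp add: vec_eq_iff)
    also have "\<dots> \<longleftrightarrow> (\<forall>j\<in>{i \<in> {1..CARD('p)}. lam i \<le> 0}. y \<bullet> v j = 0)"
      by (simp only: \<open>range (\<lambda>i. k + pos i) = _\<close> nonpos)
    finally show ?thesis
      by blast
  qed
  have S_ext: "S = ext"
    unfolding S_def assms(2) by (rule ker_plus_V_plus)
  have S_Vg: "S = {(x, x'). Vg *v (A *v x + B *v x') = 0}"
    unfolding S_ext Vg_iff ..
  have mono: "monotone_operator (operator_of ker)"
    unfolding ker by (fact assms(8))
  have "\<exists>d. (x - d, x' + d) \<in> S" for x x'
  proof -
    \<comment> \<open>Membership of \<open>(x - d, x' + d)\<close> in \<open>S\<close> is the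
      equation \<open>E d = Vg *v (A *v x + B *v x')\<close>. As \<open>Vg\<close> has n rows,
      \<open>E\<close> is an endomorphism, so its injectivity makes the equation solvable.\<close>
    define E where "E d = Vg *v (A *v d - B *v d)" for d
    have lin: "linear E"
      unfolding E_def
      by (rule linearI) (simp_all add: matrix_vector_right_distrib matrix_vector_mult_scaleR
          matrix_vector_mult_diff_distrib algebra_simps)
    have "d = 0" if "E d = 0" for d
    proof (rule antidiagonal_ext_eq_0[OF mono])
      show "(d, - d) \<in> ext"
        using that unfolding S_ext[symmetric] S_Vg by (simp add: E_def vec.neg)
    qed
    then have "surj E"
      using lin by (simp add: linear_injective_0 linear_injective_imp_surjective)
    then obtain d where "E d = Vg *v (A *v x + B *v x')"
      by (metis surjD)
    then have "(x - d, x' + d) \<in> S"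
      unfolding S_Vg
      by (simp add: E_def matrix_vector_right_distrib matrix_vector_mult_diff_distrib algebra_simps)
    then show ?thesis ..
  qed
  then have "maximally_monotone (operator_of S)"
    using monotone_ext[OF mono]
    by (intro maximally_monotone_if_antidiagonal_complement) (simp_all only: S_ext)
  moreover have "S = {(x, x'). (Vg ** A) *v x + (Vg ** B) *v x' = 0}"
    unfolding S_Vg by (simp add: matrix_vector_right_distrib matrix_vector_mul_assoc)
  moreover have "linear_relation (operator_of S)"
    using subspace_ext by (simp add: linear_relation_def S_ext)
  moreover have "extends (operator_of S) G"
    by (auto simp: extends_def assms(2) S_ext)
  ultimately show ?thesis
    by blast
qed

end
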